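(* Let $n\ge 2$, $m\ge 1$ and $d\in\{1,\dots,n-1\}$ be integers such that $\gcd(m,n)$ divides $d$, and assume that all the $n$ processes invoke $\mathsf{elect}()$. Then Algorithm 2 (given in the context) solves exact $d$-election in a fully anonymous system of $n$ processes and $m$ registers, where communication is through RMW registers.
   Context: System. There are $n$ asynchronous processes $p_1,\dots,p_n$ and $m$ shared atomic registers. An execution is an interleaving of atomic steps; in each step one process performs one operation on one register and updates its local state. Processes do not crash: every participating process that has not yet returned keeps taking steps; otherwise the interleaving is arbitrary. Algorithms may depend on $n,m,d$. RMW registers. The operations on a register $X$ are read, write, and $\mathsf{compare\&swap}(X,\mathrm{old},\mathrm{new})$, which atomically does the following: if $X=\mathrm{old}$ it assigns $\mathrm{new}$ to $X$ and returns true, otherwise it leaves $X$ unchanged and returns false. Full anonymity. The processes have no identities, run the same code and have the same initial local state (the subscript $i$ is only an external notation). The memory is anonymous: an adversary chooses, for each process $p_i$, a permutation $f_i$ of $\{1,\dots,m\}$, unknown to all the processes; when $p_i$ uses the name $R[x]$ it accesses the register $R[f_i(x)]$. All registers have the same initial value. Exact $d$-election. Each participating process invokes $\mathsf{elect}()$ (once), which returns either "leader" or "not leader"; a process that returns "leader" is elected. An algorithm solves exact $d$-election if in every execution, for every choice of the permutations $f_i$, every participating process eventually returns, and exactly $d$ processes are elected. Here participation is required: all $n$ processes participate. Algorithm 2 (code of $\mathsf{elect}()$ for $p_i$). Let $u$ and $v$ be the smallest positive integers such that $u\times m=v\times n+d$. All shared registers are initially $0$; the local variables are $won_i$ (initially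 $0$), $sum_i$ (initially $0$) and $myview_i[1..m]$. 1. repeat 2. $\quad$ for each $j\in\{1,\dots,m\}$: $myview_i[j]\leftarrow R[j]$; 3. $\quad sum_i\leftarrow myview_i[1]+\cdots+myview_i[m]$; 4. $\quad$ if there is $x\in\{1,\dots,m\}$ with $myview_i[x]<u$ then (for such an $x$) 5. $\quad\quad$ if $won_i<v$ then 6. $\quad\quad\quad$ if $\mathsf{compare\&swap}(R[x],myview_i[x],myview_i[x]+1)$ then $won_i\leftarrow won_i+1$; (end if of line 5) 7. $\quad\quad$ if $sum_i\ge v\times n$ then 8. $\quad\quad\quad$ if $\mathsf{compare\&swap}(R[x],myview_i[x],myview_i[x]+1)$ then return "leader"; (end if of line 7) 9. $\quad$ (end if of line 4) 10. until $sum_i=u\times m$; 11. return "not leader". *)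

theory Defs
  imports "HOL-Combinatorics.Permutations"
begin

section \<open>Fully anonymous systems with RMW registers\<close>

datatype 'v operation = Read | Write 'v | CAS (expected: 'v) (desired: 'v)

datatype 'v response = Value 'v | Ack | Flag bool

text \<open>Atomic effect of an operation on a register holding \<open>a\<close>: the response and the
  new contents.\<close>

fun perform :: "'v operation \<Rightarrow> 'v \<Rightarrow> 'v response \<times> 'v" where
  "perform Read a = (Value a, a)"
| "perform (Write b) a = (Ack, b)"
| "perform (CAS old new) a = (if a = old then (Flag True, new) else (Flag False, a))"

datatype outcome = Leader | NotLeader

text \<open>The common code of all processes. It has no access to a process index, so processes are
  anonymous. In local state \<open>s\<close> a process performs one of the operations \<open>(x, op)\<close> in
  \<open>ops s\<close>, where \<open>x\<close> is its own name for a register, and on response \<open>r\<close> moves to one of the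
  states in \<open>succs s x op r\<close>. The sets express choices that the code leaves open.
  \<open>result s = Some o\<close> means that the process has returned \<open>o\<close>.\<close>

record ('s, 'v) algorithm =
  init_reg :: 'v
  init_local :: 's
  ops :: "'s \<Rightarrow> (nat \<times> 'v operation) set"
  succs :: "'s \<Rightarrow> nat \<Rightarrow> 'v operation \<Rightarrow> 'v response \<Rightarrow> 's set"
  result :: "'s \<Rightarrow> outcome option"

record ('s, 'v) config =
  locals :: "nat \<Rightarrow> 's"
  regs :: "nat \<Rightarrow> 'v"

definition initial :: "('s, 'v) algorithm \<Rightarrow> ('s, 'v) config" where
  "initial A = \<lparr>locals = (\<lambda>_. init_local A), regs = (\<lambda>_. init_reg A)\<rparr>"

definition returned :: "('s, 'v) algorithm \<Rightarrow> ('s, 'v) config \<Rightarrow> nat \<Rightarrow> outcome option" where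
  "returned A C i = result A (locals C i)"

text \<open>One atomic step of process \<open>i\<close>; its name \<open>x\<close> denotes the register \<open>f i x\<close>.\<close>

definition step ::
  "('s, 'v) algorithm \<Rightarrow> nat \<Rightarrow> (nat \<Rightarrow> nat \<Rightarrow> nat) \<Rightarrow> nat \<Rightarrow> ('s, 'v) config \<Rightarrow> ('s, 'v) config \<Rightarrow> bool"
where
  "step A m f i C C' \<longleftrightarrow>
     returned A C i = None \<and>
     (\<exists>x op r a s'.
        (x, op) \<in> ops A (locals C i) \<and> x \<in> {1..m} \<and>
        perform op (regs C (f i x)) = (r, a) \<and>
        s' \<in> succs A (locals C i) x op r \<and>
        C' = \<lparr>locals = (locals C)(i := s'), regs = (regs C)(f i x := a)\<rparr>)"

text \<open>\<open>C t\<close> is the configuration at time \<open>t\<close>, and \<open>sched t\<close> the process scheduled at time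
  \<open>t\<close>. Scheduling a process that has no step (in particular, one that has returned) changes
  nothing. Hence executions in which all processes return are padded to infinite length, and
  an algorithm cannot solve a problem vacuously by blocking: a process that is stuck without
  having returned stays unreturned in a legal execution.\<close>

definition execution ::
  "('s, 'v) algorithm \<Rightarrow> nat \<Rightarrow> nat \<Rightarrow> (nat \<Rightarrow> nat \<Rightarrow> nat) \<Rightarrow> (nat \<Rightarrow> nat) \<Rightarrow> (nat \<Rightarrow> ('s, 'v) config) \<Rightarrow> bool"
where
  "execution A n m f sched C \<longleftrightarrow>
     C 0 = initial A \<and>
     (\<forall>t. sched t \<in> {1..n}) \<and>
     (\<forall>t. if \<exists>C'. step A m f (sched t) (C t) C'
          then step A m f (sched t) (C t) (C (Suc t))
          else C (Suc t) = C t) \<and>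
     (\<forall>i\<in>{1..n}. \<forall>t. returned A (C t) i = None \<longrightarrow> (\<exists>t'\<ge>t. sched t' = i))"

definition solves_exact_election ::
  "nat \<Rightarrow> nat \<Rightarrow> nat \<Rightarrow> ('s, 'v) algorithm \<Rightarrow> bool"
where
  "solves_exact_election n m d A \<longleftrightarrow>
     (\<forall>f sched C.
        (\<forall>i\<in>{1..n}. f i permutes {1..m}) \<longrightarrow>
        execution A n m f sched C \<longrightarrow>
        (\<forall>i\<in>{1..n}. \<exists>t. returned A (C t) i \<noteq> None) \<and>
        card {i \<in> {1..n}. \<exists>t. returned A (C t) i = Some Leader} = d)"

section \<open>The algorithm\<close>

text \<open>For \<open>m, n > 0\<close> the positive solutions \<open>(u, v)\<close> of \<open>u * m = v * n + d\<close> form a chain in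
  the componentwise order (\<open>v\<close> increases with \<open>u\<close>), so the two minima below are attained by
  the same solution.\<close>

definition least_u :: "nat \<Rightarrow> nat \<Rightarrow> nat \<Rightarrow> nat" where
  "least_u n m d = (LEAST u. u > 0 \<and> (\<exists>v>0. u * m = v * n + d))"

definition least_v :: "nat \<Rightarrow> nat \<Rightarrow> nat \<Rightarrow> nat" where
  "least_v n m d = (LEAST v. v > 0 \<and> (\<exists>u>0. u * m = v * n + d))"

text \<open>The code, with line numbers (control points are the places where a register is accessed;
  purely local lines are executed together with the preceding access):

  \<^item> 1. repeat
  \<^item> 2. for each \<open>j \<in> {1..m}\<close>: \<open>myview[j] := R[j]\<close>
  \<^item> 3. \<open>total := myview[1] + ... + myview[m]\<close>
  \<^item> 4. if there is \<open>x \<in> {1..m}\<close> with \<open>myview[x] < u\<close> then, for such an \<open>x\<close>,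
  \<^item> 5-6. if \<open>won < v\<close> then if \<open>CAS(R[x], myview[x], myview[x] + 1)\<close> then \<open>won := won + 1\<close>
  \<^item> 7-8. if \<open>total \<ge> v * n\<close> then if \<open>CAS(R[x], myview[x], myview[x] + 1)\<close> then return Leader
  \<^item> 10. until \<open>total = u * m\<close>
  \<^item> 11. return NotLeader

  \<open>Collect J\<close>: in the loop of line 2, with the names in \<open>J\<close> still to be read (in any order).
  \<open>Line6 x\<close> and \<open>Line8 x\<close>: about to perform the CAS of that line on \<open>R[x]\<close>.\<close>

datatype control = Collect "nat set" | Line6 nat | Line8 nat | Returned outcome

record local_state =
  pc :: control
  won :: nat
  total :: nat
  myview :: "nat \<Rightarrow> nat"

locale election_code =
  fixes n m u v :: nat
begin

definition line10 :: "local_state \<Rightarrow> local_state" where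
  "line10 s = s\<lparr>pc := if total s = u * m then Returned NotLeader else Collect {1..m}\<rparr>"

definition line7 :: "nat \<Rightarrow> local_state \<Rightarrow> local_state" where
  "line7 x s = (if total s \<ge> v * n then s\<lparr>pc := Line8 x\<rparr> else line10 s)"

definition line5 :: "nat \<Rightarrow> local_state \<Rightarrow> local_state" where
  "line5 x s = (if won s < v then s\<lparr>pc := Line6 x\<rparr> else line7 x s)"

definition line4 :: "local_state \<Rightarrow> local_state set" where
  "line4 s =
     (if \<exists>x\<in>{1..m}. myview s x < u
      then {line5 x s | x. x \<in> {1..m} \<and> myview s x < u}
      else {line10 s})"

definition line3 :: "local_state \<Rightarrow> local_state set" where
  "line3 s = line4 (s\<lparr>total := (\<Sum>j=1..m. myview s j)\<rparr>)"

definition code_ops :: "local_state \<Rightarrow> (nat \<times> nat operation) set" where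
  "code_ops s =
     (case pc s of
        Collect J \<Rightarrow> {(j, Read) | j. j \<in> J}
      | Line6 x \<Rightarrow> {(x, CAS (myview s x) (myview s x + 1))}
      | Line8 x \<Rightarrow> {(x, CAS (myview s x) (myview s x + 1))}
      | Returned _ \<Rightarrow> {})"

definition code_succs ::
  "local_state \<Rightarrow> nat \<Rightarrow> nat operation \<Rightarrow> nat response \<Rightarrow> local_state set"
where
  "code_succs s j op r =
     (case (pc s, r) of
        (Collect J, Value a) \<Rightarrow>
          (let s' = s\<lparr>myview := (myview s)(j := a), pc := Collect (J - {j})\<rparr>
           in if J - {j} = {} then line3 s' else {s'})
      | (Line6 x, Flag b) \<Rightarrow> {line7 x (if b then s\<lparr>won := won s + 1\<rparr> else s)}
      | (Line8 x, Flag b) \<Rightarrow> {if b then s\<lparr>pc := Returned Leader\<rparr> else line10 s}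
      | _ \<Rightarrow> {})"

definition code_result :: "local_state \<Rightarrow> outcome option" where
  "code_result s = (case pc s of Returned q \<Rightarrow> Some q | _ \<Rightarrow> None)"

text \<open>The initial contents of \<open>myview\<close> are irrelevant: every entry is read before it is used.\<close>

definition code :: "(local_state, nat) algorithm" where
  "code =
     \<lparr>init_reg = 0,
      init_local = \<lparr>pc = Collect {1..m}, won = 0, total = 0, myview = (\<lambda>_. 0)\<rparr>,
      ops = code_ops,
      succs = code_succs,
      result = code_result\<rparr>"

end

definition election_algorithm :: "nat \<Rightarrow> nat \<Rightarrow> nat \<Rightarrow> (local_state, nat) algorithm" where
  "election_algorithm n m d = election_code.code n m (least_u n m d) (least_v n m d)"

end

theory Submission
  imports Defs "HOL-Number_Theory.Cong"
begin

text \<open>Every increment of a register is charged either to a counter \<open>won\<close> (at most \<open>v\<close> per process) or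
  to an elected process. A leader is elected only after the registers have reached the sum
  \<open>v * n\<close>, when every counter has reached \<open>v\<close>; as the registers are bounded by \<open>u\<close>, at most
  \<open>u * m - v * n = d\<close> leaders are elected, and a process returns \<open>NotLeader\<close> only when the
  registers are full, that is, when \<open>d\<close> leaders exist. The registers increase and are
  bounded, so they are eventually constant. A process that keeps running then reads
  exact values, and since its CAS cannot succeed it has \<open>won \<ge> v\<close> while the sum
  is below \<open>v * n\<close>. In that case no process has returned, so all of them have \<open>won \<ge> v\<close>,
  which contradicts that the sum is below \<open>v * n\<close>.\<close>

section \<open>Solvability of the equation between \<open>u\<close> and \<open>v\<close>\<close>

lemma least_solution:
  fixes n m d :: nat
  assumes "n > 0" "m > 0" "gcd m n dvd d"
  shows "least_u n m d * m = least_v n m d * n + d"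
proof -
  have "\<exists>u v. u > 0 \<and> v > 0 \<and> u * m = v * n + d"
  proof -
    obtain a where a: "[m * a = d] (mod n)" using cong_solve_dvd_nat[OF assms(3)] by blast
    \<comment> \<open>Adding a multiple of \<open>n\<close> keeps the congruence and makes
      \<open>w\<close> larger than \<open>d\<close>; hence \<open>w * m > d\<close>, which is what
      makes the quotient \<open>v\<close> positive.\<close>
    define w where "w = a + n * (d + 1)"
    have "w * m = m * a + n * ((d + 1) * m)" by (simp add: w_def algebra_simps)
    then have cong: "[w * m = d] (mod n)" using a by (simp add: cong_def)
    have "1 * (d + 1) \<le> n * (d + 1)" using assms(1) by (intro mult_le_mono1) simp
    then have "w \<ge> d + 1" by (simp add: w_def)
    moreover have "w * m \<ge> w" using assms(2) by simp
    ultimately have gt: "w * m > d" by linarith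
    then obtain v where v: "w * m = v * n + d"
      using cong cong_le_nat[of d "w * m" n] cong_sym by (metis less_imp_le)
    then have "v > 0" using gt by (cases v) auto
    moreover have "w > 0" using \<open>w \<ge> d + 1\<close> by simp
    ultimately show ?thesis using v by blast
  qed
  then obtain u0 v0 where uv0: "u0 > 0" "v0 > 0" "u0 * m = v0 * n + d" by blast
  let ?u = "least_u n m d" and ?v = "least_v n m d"
  have "?u > 0 \<and> (\<exists>v>0. ?u * m = v * n + d)"
    unfolding least_u_def by (rule LeastI_ex) (use uv0 in blast)
  then obtain v' where v': "?u > 0" "v' > 0" "?u * m = v' * n + d" by blast
  have "?v > 0 \<and> (\<exists>u>0. u * m = ?v * n + d)"
    unfolding least_v_def by (rule LeastI_ex) (use uv0 in blast)
  then obtain u' where u': "?v > 0" "u' > 0" "u' * m = ?v * n + d" by blast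
  \<comment> \<open>\<open>v'\<close> is the partner of the least \<open>u\<close>, and
    \<open>u'\<close> the partner of the least \<open>v\<close>. Since \<open>u\<close> and
    \<open>v\<close> grow together in the equation, \<open>?v \<le> v'\<close> gives
    \<open>u' \<le> ?u\<close>, so both minima belong to one solution.\<close>
  have "?u \<le> u'" unfolding least_u_def by (rule Least_le) (use u' in blast)
  have "?v \<le> v'" unfolding least_v_def by (rule Least_le) (use v' in blast)
  then have "?v * n \<le> v' * n" by simp
  then have "u' * m \<le> ?u * m" using u'(3) v'(3) by linarith
  then have "u' = ?u" using \<open>?u \<le> u'\<close> assms(2) by simp
  then show ?thesis using u'(3) by simp
qed

text \<open>Induction on \<open>rank\<close>: fairness always provides a next turn of
  \<open>i\<close>, and between its turns the state is frozen, so \<open>rank\<close> cannot drop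
  forever without \<open>G\<close> being reached. The predicate \<open>P\<close> carries what must
  survive along the descent, and \<open>T\<close> restricts it to late times.\<close>

lemma descent_along_schedule:
  fixes rank :: "'s \<Rightarrow> nat"
  assumes fair: "\<And>t. \<exists>t'\<ge>t. sched t' = i"
    and idle: "\<And>t. sched t \<noteq> i \<Longrightarrow> s (Suc t) = s t"
    and move: "\<And>t. \<lbrakk>t \<ge> T; sched t = i; P (s t)\<rbrakk>
      \<Longrightarrow> G (s (Suc t)) \<or> P (s (Suc t)) \<and> rank (s (Suc t)) < rank (s t)"
    and "T \<le> t" "P (s t)"
  shows "\<exists>t'\<ge>t. G (s t')"
  using assms(4,5)
proof (induction "rank (s t)" arbitrary: t rule: less_induct)
  case less
  \<comment> \<open>The first turn of \<open>i\<close> from \<open>t\<close> on; the state is still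
    \<open>s t\<close> there, so \<open>move\<close> applies to it.\<close>
  define t' where "t' = (LEAST t'. t \<le> t' \<and> sched t' = i)"
  have t': "t \<le> t' \<and> sched t' = i"
    unfolding t'_def by (rule LeastI_ex) (use fair in blast)
  have before: "sched r \<noteq> i" if "t \<le> r" "r < t'" for r
    using that not_less_Least[of r "\<lambda>t'. t \<le> t' \<and> sched t' = i"] unfolding t'_def by blast
  have same: "r \<le> t' \<Longrightarrow> s r = s t" if "t \<le> r" for r
    using that by (induction r rule: dec_induct) (use idle before in auto)
  have "s t' = s t" using same t' by blast
  then consider "G (s (Suc t'))" | "P (s (Suc t'))" "rank (s (Suc t')) < rank (s t)"
    using move[of t'] t' less.prems by (metis le_trans)
  then show ?case
  proof cases
    case 1
    then show ?thesis using t' by (meson le_SucI)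
  next
    case 2
    then have "\<exists>r\<ge>Suc t'. G (s r)" using less.hyps[of "Suc t'"] t' less.prems(1) by simp
    then show ?thesis using t' by (meson Suc_leD le_trans)
  qed
qed

text \<open>These entries of \<open>myview\<close> still come from the previous pass of the loop, or
  are initial values; statements about what has been read in the present pass exclude them.\<close>

fun pending :: "control \<Rightarrow> nat set" where
  "pending (Collect J) = J"
| "pending _ = {}"

section \<open>Case analysis of the code\<close>

context election_code
begin

lemma line10_cases:
  obtains (again) "line10 s = s\<lparr>pc := Collect {1..m}\<rparr>" "total s \<noteq> u * m"
  | (exit) "line10 s = s\<lparr>pc := Returned NotLeader\<rparr>" "total s = u * m"
  by (auto simp: line10_def split: if_splits)

lemma line7_cases:
  obtains (line8) "line7 x s = s\<lparr>pc := Line8 x\<rparr>" "v * n \<le> total s"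
  | (again) "line7 x s = s\<lparr>pc := Collect {1..m}\<rparr>" "total s < v * n" "total s \<noteq> u * m"
  | (exit) "line7 x s = s\<lparr>pc := Returned NotLeader\<rparr>" "total s = u * m"
  by (cases "v * n \<le> total s"; cases "total s = u * m") (auto simp: line7_def line10_def)

text \<open>Summarizes all local lines between the last read and the next access. The third fact in
  \<open>again\<close> records why a pass ends without any attempted CAS; termination rests on
  it.\<close>

lemma line3_cases:
  assumes "s' \<in> line3 s"
  obtains
    (line6) x where "s' = s\<lparr>total := sum (myview s) {1..m}, pc := Line6 x\<rparr>"
      "x \<in> {1..m}" "myview s x < u" "won s < v"
  | (line8) x where "s' = s\<lparr>total := sum (myview s) {1..m}, pc := Line8 x\<rparr>"
      "x \<in> {1..m}" "myview s x < u" "v * n \<le> sum (myview s) {1..m}"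
  | (again) "s' = s\<lparr>total := sum (myview s) {1..m}, pc := Collect {1..m}\<rparr>"
      "sum (myview s) {1..m} \<noteq> u * m"
      "(\<forall>x\<in>{1..m}. u \<le> myview s x) \<or> v \<le> won s \<and> sum (myview s) {1..m} < v * n"
  | (exit) "s' = s\<lparr>total := sum (myview s) {1..m}, pc := Returned NotLeader\<rparr>"
      "sum (myview s) {1..m} = u * m"
proof (cases "\<exists>x\<in>{1..m}. myview s x < u")
  case True
  let ?s = "s\<lparr>total := sum (myview s) {1..m}\<rparr>"
  have view: "myview ?s = myview s" by simp
  have "s' \<in> {line5 x ?s | x. x \<in> {1..m} \<and> myview s x < u}"
    using assms unfolding line3_def line4_def view if_P[OF True] .
  then obtain x where x: "x \<in> {1..m}" "myview s x < u" "s' = line5 x ?s" by blast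
  show ?thesis
  proof (cases "won s < v")
    case True
    then show ?thesis using line6[of x] x by (simp add: line5_def)
  next
    case False
    then have s': "s' = line7 x ?s" using x(3) by (simp add: line5_def)
    show ?thesis
      by (cases x ?s rule: line7_cases) (use s' x False line8[of x] again exit in simp_all)
  qed
next
  case False
  let ?s = "s\<lparr>total := sum (myview s) {1..m}\<rparr>"
  have view: "myview ?s = myview s" by simp
  have "s' \<in> {line10 ?s}"
    using assms unfolding line3_def line4_def view if_not_P[OF False] .
  moreover have "\<forall>x\<in>{1..m}. u \<le> myview s x" using False by (simp add: not_less)
  ultimately show ?thesis
    by (cases ?s rule: line10_cases) (use again exit in simp_all)
qed

text \<open>The last read of a pass is separated from the others because the local lines are
  executed together with it, and successful CAS operations from failed ones because only the former
  change a register.\<close>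

lemma step_code_cases:
  assumes "step code m f i C C'"
  obtains
    (collect) J j s' where "pc (locals C i) = Collect J" "j \<in> J" "j \<in> {1..m}"
      "J - {j} \<noteq> {}"
      "s' = (locals C i)\<lparr>myview := (myview (locals C i))(j := regs C (f i j)), pc := Collect (J - {j})\<rparr>"
      "locals C' = (locals C)(i := s')" "regs C' = regs C"
  | (collected) j s' where "pc (locals C i) = Collect {j}" "j \<in> {1..m}"
      "s' \<in> line3 ((locals C i)\<lparr>myview := (myview (locals C i))(j := regs C (f i j)), pc := Collect {}\<rparr>)"
      "locals C' = (locals C)(i := s')" "regs C' = regs C"
  | (won) x where "pc (locals C i) = Line6 x" "x \<in> {1..m}"
      "regs C (f i x) = myview (locals C i) x"
      "locals C' = (locals C)(i := line7 x ((locals C i)\<lparr>won := won (locals C i) + 1\<rparr>))"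
      "regs C' = (regs C)(f i x := regs C (f i x) + 1)"
  | (elected) x where "pc (locals C i) = Line8 x" "x \<in> {1..m}"
      "regs C (f i x) = myview (locals C i) x"
      "locals C' = (locals C)(i := (locals C i)\<lparr>pc := Returned Leader\<rparr>)"
      "regs C' = (regs C)(f i x := regs C (f i x) + 1)"
  | (failed6) x where "pc (locals C i) = Line6 x"
      "regs C (f i x) \<noteq> myview (locals C i) x"
      "locals C' = (locals C)(i := line7 x (locals C i))" "regs C' = regs C"
  | (failed8) x where "pc (locals C i) = Line8 x"
      "regs C (f i x) \<noteq> myview (locals C i) x"
      "locals C' = (locals C)(i := line10 (locals C i))" "regs C' = regs C"
proof -
  obtain x oper r a s' where h: "(x, oper) \<in> code_ops (locals C i)" "x \<in> {1..m}"
    "perform oper (regs C (f i x)) = (r, a)"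
    "s' \<in> code_succs (locals C i) x oper r"
    "C' = \<lparr>locals = (locals C)(i := s'), regs = (regs C)(f i x := a)\<rparr>"
    using assms unfolding step_def code_def by auto
  show ?thesis
  proof (cases "pc (locals C i)")
    case (Collect J)
    with h have x: "x \<in> J" "r = Value (regs C (f i x))" "a = regs C (f i x)"
      by (auto simp: code_ops_def)
    show ?thesis
    proof (cases "J - {x} = {}")
      case True
      then have "J = {x}" using x by auto
      then show ?thesis using collected[of x s'] h Collect x by (simp add: code_succs_def)
    next
      case False
      then show ?thesis using collect[of J x s'] h Collect x
        by (simp add: code_succs_def Let_def)
    qed
  next
    case (Line6 y)
    with h won[of y] failed6[of y] show ?thesis
      by (auto simp: code_ops_def code_succs_def split: if_splits)
  next
    case (Line8 y)
    with h elected[of y] failed8[of y] show ?thesis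
      by (auto simp: code_ops_def code_succs_def split: if_splits)
  next
    case (Returned q)
    with h show ?thesis by (simp add: code_ops_def)
  qed
qed

lemma returned_code: "returned code C i = (case pc (locals C i) of Returned q \<Rightarrow> Some q | _ \<Rightarrow> None)"
  by (simp add: returned_def code_def code_result_def)

text \<open>An execution lets a stuck process idle, so progress has to be proved: the hypotheses
  exclude a \<open>Collect\<close> with nothing left to read and names outside the memory.\<close>

lemma step_enabled:
  assumes "returned code C i = None" "pending (pc (locals C i)) \<subseteq> {1..m}"
    and "\<And>J. pc (locals C i) = Collect J \<Longrightarrow> J \<noteq> {}"
    and "\<And>x. pc (locals C i) \<in> {Line6 x, Line8 x} \<Longrightarrow> x \<in> {1..m}"
  shows "\<exists>C'. step code m f i C C'"
proof -
  let ?s = "locals C i"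
  have "\<exists>x oper. (x, oper) \<in> code_ops ?s \<and> x \<in> {1..m} \<and>
      code_succs ?s x oper (fst (perform oper (regs C (f i x)))) \<noteq> {}"
  proof (cases "pc ?s")
    case (Collect J)
    with assms(2,3) obtain j where "j \<in> J" "j \<in> {1..m}" by fastforce
    moreover have "line3 s \<noteq> {}" for s by (auto simp: line3_def line4_def)
    ultimately show ?thesis using Collect
      by (intro exI[of _ j] exI[of _ Read]) (simp add: code_ops_def code_succs_def Let_def)
  next
    case (Line6 x)
    then show ?thesis using assms(4)[of x] by (auto simp: code_ops_def code_succs_def)
  next
    case (Line8 x)
    then show ?thesis using assms(4)[of x] by (auto simp: code_ops_def code_succs_def)
  next
    case (Returned q)
    then show ?thesis using assms(1) by (simp add: returned_code)
  qed
  then obtain x oper s' where "(x, oper) \<in> code_ops ?s" "x \<in> {1..m}"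
    "s' \<in> code_succs ?s x oper (fst (perform oper (regs C (f i x))))"
    by blast
  then show ?thesis using assms(1) unfolding step_def
    by (simp add: code_def) (metis prod.collapse)
qed

end

section \<open>Invariants of single steps\<close>

locale election_system = election_code n m u v for n m u v :: nat +
  fixes d :: nat and f :: "nat \<Rightarrow> nat \<Rightarrow> nat"
  assumes perm: "\<And>i. i \<in> {1..n} \<Longrightarrow> f i permutes {1..m}"
    and balance: "u * m = v * n + d"
    and d_pos: "0 < d" and d_less: "d < n"
begin

text \<open>Reading the memory is not atomic, so \<open>myview\<close> and \<open>total\<close> are
  only lower bounds for the present contents \<open>g\<close>. As \<open>g\<close> occurs in upper
  bounds only, increments by other processes preserve the predicate.\<close>

definition local_inv :: "(nat \<Rightarrow> nat) \<Rightarrow> nat \<Rightarrow> local_state \<Rightarrow> bool" where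
  "local_inv g i s \<longleftrightarrow>
     won s \<le> v \<and> total s \<le> sum g {1..m} \<and>
     (\<forall>j\<in>{1..m} - pending (pc s). myview s j \<le> g (f i j)) \<and>
     (case pc s of
        Collect J \<Rightarrow> J \<subseteq> {1..m} \<and> J \<noteq> {}
      | Line6 x \<Rightarrow> x \<in> {1..m} \<and> myview s x < u \<and> won s < v
      | Line8 x \<Rightarrow> x \<in> {1..m} \<and> myview s x < u \<and> v * n \<le> total s
      | Returned q \<Rightarrow> q = NotLeader \<longrightarrow> total s = u * m)"

definition leaders :: "(local_state, nat) config \<Rightarrow> nat set" where
  "leaders C = {i \<in> {1..n}. pc (locals C i) = Returned Leader}"

text \<open>The equation charges each increment to a counter or to a leader. The last conjunct makes
  every counter exhausted from the first election on, so that the sum then exceeds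
  \<open>v * n\<close> by exactly the number of leaders.\<close>

definition inv :: "(local_state, nat) config \<Rightarrow> bool" where
  "inv C \<longleftrightarrow>
     (\<forall>i\<in>{1..n}. local_inv (regs C) i (locals C i)) \<and>
     (\<forall>y\<in>{1..m}. regs C y \<le> u) \<and>
     sum (regs C) {1..m} = (\<Sum>i\<in>{1..n}. won (locals C i)) + card (leaders C) \<and>
     (leaders C \<noteq> {} \<longrightarrow> (\<forall>i\<in>{1..n}. won (locals C i) = v))"

lemma m_pos: "1 \<le> m"
  using balance d_pos by (cases m) auto

lemma f_in: "i \<in> {1..n} \<Longrightarrow> x \<in> {1..m} \<Longrightarrow> f i x \<in> {1..m}"
  using permutes_in_image[OF perm] by blast

lemma sum_reindex: "i \<in> {1..n} \<Longrightarrow> (\<Sum>j\<in>{1..m}. g (f i j)) = sum g {1..m}"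
  using sum.permute[OF perm, of i g] by (simp add: o_def)

lemma sum_increment:
  fixes g :: "nat \<Rightarrow> nat"
  assumes "y \<in> A" "finite A"
  shows "sum (g(y := g y + 1)) A = sum g A + 1"
  using assms by (simp add: sum.remove[of A y])

lemma local_inv_mono:
  assumes "local_inv g i s" "\<And>y. g y \<le> g' y"
  shows "local_inv g' i s"
proof -
  have "sum g {1..m} \<le> sum g' {1..m}" using assms(2) by (simp add: sum_mono)
  then show ?thesis using assms(1) assms(2) unfolding local_inv_def
    by (meson le_trans)
qed

lemma local_inv_line10:
  assumes "local_inv g i s" "pending (pc s) = {}"
  shows "local_inv g i (line10 s)"
  using assms m_pos by (cases s rule: line10_cases) (auto simp: local_inv_def)

lemma local_inv_line7:
  assumes "won s \<le> v" "total s \<le> sum g {1..m}" "\<forall>j\<in>{1..m}. myview s j \<le> g (f i j)"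
    and "x \<in> {1..m}" "myview s x < u"
  shows "local_inv g i (line7 x s)"
  using assms m_pos by (cases x s rule: line7_cases) (auto simp: local_inv_def)

lemma regs_mono_step:
  assumes "step code m f i C C'"
  shows "regs C y \<le> regs C' y"
  using assms by (cases rule: step_code_cases) auto

lemma local_inv_step:
  assumes st: "step code m f i C C'" and i: "i \<in> {1..n}"
    and li: "local_inv (regs C) i (locals C i)"
  shows "local_inv (regs C') i (locals C' i)"
  using st
proof (cases rule: step_code_cases)
  case (collect J j s')
  let ?s = "(locals C i)\<lparr>myview := (myview (locals C i))(j := regs C (f i j)), pc := Collect (J - {j})\<rparr>"
  have J: "J \<subseteq> {1..m}" "won (locals C i) \<le> v" "total (locals C i) \<le> sum (regs C) {1..m}"
    "\<forall>k\<in>{1..m} - J. myview (locals C i) k \<le> regs C (f i k)"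
    using li collect(1) by (simp_all add: local_inv_def)
  then have "local_inv (regs C) i ?s" using collect(4) unfolding local_inv_def by auto
  then show ?thesis using collect(5-7) by simp
next
  case (collected j s')
  let ?s = "(locals C i)\<lparr>myview := (myview (locals C i))(j := regs C (f i j)), pc := Collect {}\<rparr>"
  \<comment> \<open>The entries may stem from different moments, but none exceeds its present
    register. Reindexing along the permutation \<open>f i\<close> then bounds the new
    \<open>total\<close> by the sum of the registers.\<close>
  have view: "\<forall>k\<in>{1..m}. myview ?s k \<le> regs C (f i k)"
  proof -
    have "\<forall>k\<in>{1..m} - {j}. myview (locals C i) k \<le> regs C (f i k)"
      using li collected(1) by (simp add: local_inv_def)
    then show ?thesis by auto
  qed
  then have "sum (myview ?s) {1..m} \<le> (\<Sum>k\<in>{1..m}. regs C (f i k))"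
    by (intro sum_mono) blast
  then have sum: "sum (myview ?s) {1..m} \<le> sum (regs C) {1..m}"
    using sum_reindex[OF i, of "regs C"] by simp
  have w: "won ?s \<le> v" using li by (simp add: local_inv_def)
  have "local_inv (regs C) i s'"
    using collected(3)
  proof (cases rule: line3_cases)
    case (line6 x)
    then show ?thesis using view sum w unfolding local_inv_def by simp
  next
    case (line8 x)
    then show ?thesis using view sum w unfolding local_inv_def by simp
  next
    case again
    then show ?thesis using view sum w m_pos unfolding local_inv_def by simp
  next
    case exit
    then show ?thesis using view sum w unfolding local_inv_def by simp
  qed
  then show ?thesis using collected by simp
next
  case (won x)
  have "local_inv (regs C') i (locals C i)"
    using local_inv_mono[OF li] regs_mono_step[OF st] by blast
  then have "local_inv (regs C') i (line7 x ((locals C i)\<lparr>won := won (locals C i) + 1\<rparr>))"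
    using won(1) by (intro local_inv_line7) (simp_all add: local_inv_def)
  then show ?thesis using won(4) by simp
next
  case (elected x)
  have "local_inv (regs C') i (locals C i)"
    using local_inv_mono[OF li] regs_mono_step[OF st] by blast
  then have "local_inv (regs C') i ((locals C i)\<lparr>pc := Returned Leader\<rparr>)"
    using elected(1) by (simp add: local_inv_def)
  then show ?thesis using elected(4) by simp
next
  case (failed6 x)
  then have "x \<in> {1..m}" "myview (locals C i) x < u" using li by (simp_all add: local_inv_def)
  then show ?thesis using local_inv_line7[of "locals C i" "regs C" i x] li failed6
    by (simp add: local_inv_def)
next
  case (failed8 x)
  then show ?thesis using local_inv_line10[OF li] by simp
qed

lemma locals_step_other:
  assumes "step code m f i C C'" "k \<noteq> i"
  shows "locals C' k = locals C k"
  using assms by (auto simp: step_def)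

lemma won_line7 [simp]: "won (line7 x s) = won s"
  by (simp add: line7_def line10_def)

lemma won_line10 [simp]: "won (line10 s) = won s"
  by (simp add: line10_def)

lemma not_Leader_line7 [simp]: "pc (line7 x s) \<noteq> Returned Leader"
  by (simp add: line7_def line10_def)

lemma not_Leader_line10 [simp]: "pc (line10 s) \<noteq> Returned Leader"
  by (simp add: line10_def)

text \<open>Keeps from the step analysis only what the global invariant depends on: the registers,
  the counter, and whether the process becomes a leader.\<close>

lemma step_effect:
  assumes "step code m f i C C'"
  obtains
    (silent) "regs C' = regs C" "won (locals C' i) = won (locals C i)"
      "pc (locals C' i) \<noteq> Returned Leader" "pc (locals C i) \<noteq> Returned Leader"
  | (won) x where "pc (locals C i) = Line6 x" "regs C (f i x) = myview (locals C i) x"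
      "regs C' = (regs C)(f i x := regs C (f i x) + 1)"
      "won (locals C' i) = won (locals C i) + 1" "pc (locals C' i) \<noteq> Returned Leader"
  | (elected) x where "pc (locals C i) = Line8 x" "regs C (f i x) = myview (locals C i) x"
      "regs C' = (regs C)(f i x := regs C (f i x) + 1)"
      "won (locals C' i) = won (locals C i)" "pc (locals C' i) = Returned Leader"
  using assms
proof (cases rule: step_code_cases)
  case (collect J j s')
  then show ?thesis using silent by simp
next
  case (collected j s')
  have "won s' = won (locals C i)" "pc s' \<noteq> Returned Leader"
    using collected(3) by (cases rule: line3_cases; simp)+
  then show ?thesis using silent collected by simp
next
  case (won x)
  then show ?thesis using that(2)[of x] by simp
next
  case (elected x)
  then show ?thesis using that(3)[of x] by simp
next
  case (failed6 x)
  then show ?thesis using silent by simp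
next
  case (failed8 x)
  then show ?thesis using silent by simp
qed

lemma finite_leaders [simp]: "finite (leaders C)"
  by (simp add: leaders_def)

lemma in_leaders_iff: "i \<in> leaders C \<longleftrightarrow> i \<in> {1..n} \<and> returned code C i = Some Leader"
  by (cases "pc (locals C i)") (auto simp: leaders_def returned_code)

text \<open>Only the summand of \<open>i\<close> can change; the additive form avoids subtraction of
  natural numbers.\<close>

lemma sum_won_step:
  assumes "step code m f i C C'" "i \<in> {1..n}"
  shows "(\<Sum>k\<in>{1..n}. won (locals C' k)) + won (locals C i)
    = (\<Sum>k\<in>{1..n}. won (locals C k)) + won (locals C' i)"
proof -
  have "(\<Sum>k\<in>{1..n} - {i}. won (locals C' k)) = (\<Sum>k\<in>{1..n} - {i}. won (locals C k))"
    using locals_step_other[OF assms(1)] by (intro sum.cong) auto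
  then show ?thesis
    using sum.remove[OF _ assms(2), of "\<lambda>k. won (locals C k)"]
      sum.remove[OF _ assms(2), of "\<lambda>k. won (locals C' k)"] by simp
qed

lemma inv_step:
  assumes st: "step code m f i C C'" and i: "i \<in> {1..n}" and inv: "inv C"
  shows "inv C'"
proof -
  have li: "local_inv (regs C) k (locals C k)" if "k \<in> {1..n}" for k
    using inv that by (simp add: inv_def)
  have li': "\<forall>k\<in>{1..n}. local_inv (regs C') k (locals C' k)"
  proof
    fix k assume k: "k \<in> {1..n}"
    show "local_inv (regs C') k (locals C' k)"
    proof (cases "k = i")
      case True
      then show ?thesis using local_inv_step[OF st i li[OF i]] by simp
    next
      case False
      then show ?thesis
        using local_inv_mono[OF li[OF k]] regs_mono_step[OF st] locals_step_other[OF st] by metis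
    qed
  qed
  have le: "\<forall>y\<in>{1..m}. regs C y \<le> u"
    and sums: "sum (regs C) {1..m} = (\<Sum>k\<in>{1..n}. won (locals C k)) + card (leaders C)"
    and full: "leaders C \<noteq> {} \<Longrightarrow> \<forall>k\<in>{1..n}. won (locals C k) = v"
    using inv by (auto simp: inv_def)
  have lead: "leaders C' = (if pc (locals C' i) = Returned Leader then insert i (leaders C - {i})
      else leaders C - {i})"
  proof (rule set_eqI)
    fix k
    show "k \<in> leaders C' \<longleftrightarrow> k \<in> (if pc (locals C' i) = Returned Leader
        then insert i (leaders C - {i}) else leaders C - {i})"
      using locals_step_other[OF st, of k] i by (cases "k = i") (auto simp: leaders_def)
  qed
  note sw = sum_won_step[OF st i]
  show ?thesis
    using st
  proof (cases rule: step_effect)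
    case silent
    have "leaders C' = leaders C" using silent lead by (auto simp: leaders_def)
    moreover have "won (locals C' k) = won (locals C k)" for k
      using silent(2) locals_step_other[OF st] by (cases "k = i") auto
    ultimately show ?thesis using li' le sums full silent(1) by (simp add: inv_def)
  next
    case (won x)
    have x: "x \<in> {1..m}" "myview (locals C i) x < u" "won (locals C i) < v"
      using li[OF i] won(1) by (auto simp: local_inv_def)
    \<comment> \<open>A counter below \<open>v\<close> shows that nobody has been elected yet, so
      the last conjunct of \<open>inv\<close> stays vacuous.\<close>
    have none: "leaders C = {}" using full x(3) i by (metis less_irrefl)
    then have "leaders C' = {}" using lead won(5) by simp
    moreover have "sum (regs C') {1..m} = sum (regs C) {1..m} + 1"
      unfolding won(3) using f_in[OF i x(1)] by (intro sum_increment) auto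
    \<comment> \<open>Since the CAS succeeded, the register held the viewed value, which is below
      \<open>u\<close>.\<close>
    moreover have "\<forall>y\<in>{1..m}. regs C' y \<le> u" using won(2,3) le x(2) by auto
    ultimately show ?thesis using li' sums none sw won(4) by (simp add: inv_def)
  next
    case (elected x)
    have x: "x \<in> {1..m}" "myview (locals C i) x < u" "v * n \<le> sum (regs C) {1..m}"
      using li[OF i] elected(1) by (auto simp: local_inv_def)
    \<comment> \<open>At the first election the counters alone account for a sum of at least
      \<open>v * n\<close>; as each is at most \<open>v\<close>, all are equal to \<open>v\<close>.
      At later elections the invariant says so.\<close>
    have allv: "\<forall>k\<in>{1..n}. won (locals C k) = v"
    proof (cases "leaders C = {}")
      case True
      have wle: "won (locals C k) \<le> v" if "k \<in> {1..n}" for k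
        using li[OF that] by (simp add: local_inv_def)
      then have "(\<Sum>k\<in>{1..n}. won (locals C k)) \<le> (\<Sum>k\<in>{1..n}. v)" by (intro sum_mono) auto
      then have "(\<Sum>k\<in>{1..n}. won (locals C k)) = (\<Sum>k\<in>{1..n}. v)"
        using True sums x(3) by (simp add: mult.commute)
      then show ?thesis using sum_mono_inv[of "\<lambda>k. won (locals C k)" "{1..n}" "\<lambda>_. v"] wle by auto
    qed (rule full)
    have "i \<notin> leaders C" using elected(1) by (simp add: leaders_def)
    then have "card (leaders C') = card (leaders C) + 1" using lead elected(5) by simp
    moreover have "sum (regs C') {1..m} = sum (regs C) {1..m} + 1"
      unfolding elected(3) using f_in[OF i x(1)] by (intro sum_increment) auto
    moreover have "\<forall>y\<in>{1..m}. regs C' y \<le> u" using elected(2,3) le x(2) by auto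
    moreover have "\<forall>k\<in>{1..n}. won (locals C' k) = v"
      using allv elected(4) locals_step_other[OF st] by metis
    ultimately show ?thesis using li' sums sw elected(4) by (simp add: inv_def)
  qed
qed

lemma inv_initial: "inv (initial code)"
  using m_pos by (auto simp: inv_def leaders_def local_inv_def initial_def code_def)

end

section \<open>Monotonicity and register sums along an execution\<close>

locale election_run = election_system n m u v d f
  for n m u v d :: nat and f :: "nat \<Rightarrow> nat \<Rightarrow> nat" +
  fixes sched :: "nat \<Rightarrow> nat" and C :: "nat \<Rightarrow> (local_state, nat) config"
  assumes exec: "execution code n m f sched C"
begin

lemma sched_in: "sched t \<in> {1..n}"
  using exec by (simp add: execution_def)

lemma next_config: "step code m f (sched t) (C t) (C (Suc t)) \<or> C (Suc t) = C t"
  using exec unfolding execution_def by metis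

lemma inv_run: "inv (C t)"
proof (induction t)
  case 0
  then show ?case using exec inv_initial by (simp add: execution_def)
next
  case (Suc t)
  then show ?case using next_config[of t] inv_step sched_in by metis
qed

lemma local_inv_run: "i \<in> {1..n} \<Longrightarrow> local_inv (regs (C t)) i (locals (C t) i)"
  using inv_run by (simp add: inv_def)

lemma step_scheduled:
  assumes "returned code (C t) (sched t) = None"
  shows "step code m f (sched t) (C t) (C (Suc t))"
proof -
  have "local_inv (regs (C t)) (sched t) (locals (C t) (sched t))"
    using local_inv_run sched_in by blast
  then have "\<exists>C'. step code m f (sched t) (C t) C'"
    by (intro step_enabled[OF assms])
      (auto simp: local_inv_def split: control.splits)
  then show ?thesis using exec unfolding execution_def by metis
qed

lemma locals_unscheduled:
  assumes "sched t \<noteq> i"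
  shows "locals (C (Suc t)) i = locals (C t) i"
  using next_config[of t] locals_step_other assms by metis

lemma regs_mono: "t \<le> t' \<Longrightarrow> regs (C t) y \<le> regs (C t') y"
  by (rule lift_Suc_mono_le[of "\<lambda>t. regs (C t) y"])
    (metis next_config order_refl regs_mono_step)

lemma won_mono: "t \<le> t' \<Longrightarrow> won (locals (C t) i) \<le> won (locals (C t') i)"
proof (rule lift_Suc_mono_le[of "\<lambda>t. won (locals (C t) i)"])
  fix t
  have "won (locals C1 k) \<le> won (locals C2 k)" if "step code m f k C1 C2" for k C1 C2
    using that by (cases rule: step_effect) auto
  then show "won (locals (C t) i) \<le> won (locals (C (Suc t)) i)"
    using next_config[of t] locals_unscheduled by (metis order_refl)
qed

lemma locals_returned:
  assumes "returned code (C t) i = Some q" "t \<le> t'"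
  shows "locals (C t') i = locals (C t) i"
  using assms(2)
proof (induction t' rule: dec_induct)
  case (step t')
  have "returned code (C t') i = Some q" using assms(1) step.IH by (simp add: returned_def)
  then have "locals (C (Suc t')) i = locals (C t') i"
    using next_config[of t'] locals_unscheduled[of t' i] by (auto simp: step_def)
  then show ?case using step.IH by simp
qed simp

lemma sum_regs_le: "sum (regs (C t)) {1..m} \<le> u * m"
proof -
  have "sum (regs (C t)) {1..m} \<le> (\<Sum>y\<in>{1..m}. u)"
    using inv_run[of t] unfolding inv_def by (intro sum_mono) blast
  then show ?thesis by (simp add: mult.commute)
qed

lemma sum_regs_won:
  "sum (regs (C t)) {1..m} = (\<Sum>i\<in>{1..n}. won (locals (C t) i)) + card (leaders (C t))"
  using inv_run[of t] by (simp add: inv_def)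

lemma sum_regs_elected:
  assumes "leaders (C t) \<noteq> {}"
  shows "sum (regs (C t)) {1..m} = v * n + card (leaders (C t))"
  using sum_regs_won[of t] inv_run[of t] assms by (simp add: inv_def)

text \<open>The returning process saw \<open>total = u * m\<close>, which is a lower bound for the
  sum now, while \<open>u * m\<close> is also its upper bound.\<close>

lemma sum_regs_NotLeader:
  assumes "i \<in> {1..n}" "returned code (C t) i = Some NotLeader"
  shows "sum (regs (C t)) {1..m} = u * m"
  using local_inv_run[OF assms(1), of t] sum_regs_le[of t] assms(2)
  by (auto simp: local_inv_def returned_code split: control.splits)

text \<open>Used in contrapositive form: while the sum is below \<open>v * n\<close>, every process
  is still running.\<close>

lemma sum_regs_returned:
  assumes "i \<in> {1..n}" "returned code (C t) i \<noteq> None"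
  shows "v * n \<le> sum (regs (C t)) {1..m}"
proof -
  obtain q where q: "returned code (C t) i = Some q" using assms(2) by blast
  show ?thesis
  proof (cases q)
    case Leader
    then have "i \<in> leaders (C t)"
      using q assms(1) by (simp add: in_leaders_iff)
    then show ?thesis using sum_regs_elected[of t] by force
  next
    case NotLeader
    then show ?thesis using sum_regs_NotLeader[OF assms(1)] q balance by simp
  qed
qed

section \<open>Termination\<close>

lemma regs_eventually_constant:
  obtains T where "\<And>t y. T \<le> t \<Longrightarrow> y \<in> {1..m} \<Longrightarrow> regs (C t) y = regs (C T) y"
proof -
  \<comment> \<open>The bounded sum attains its maximum at some \<open>T\<close>; afterwards the
    registers are pointwise at least as large with the same sum, hence equal.\<close>
  obtain T where T: "\<And>t. sum (regs (C t)) {1..m} \<le> sum (regs (C T)) {1..m}"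
    using ex_has_greatest_nat[of "\<lambda>_. True" 0 "\<lambda>t. sum (regs (C t)) {1..m}" "u * m + 1"]
      sum_regs_le by (metis add.commute le_imp_less_Suc plus_1_eq_Suc)
  have "regs (C t) y = regs (C T) y" if t: "T \<le> t" and y: "y \<in> {1..m}" for t y
  proof -
    have mono: "regs (C T) z \<le> regs (C t) z" for z using regs_mono[OF t] .
    have "sum (regs (C T)) {1..m} = sum (regs (C t)) {1..m}"
      using T mono by (simp add: order.antisym sum_mono)
    from sum_mono_inv[OF this mono y] show ?thesis by simp
  qed
  then show ?thesis using that by blast
qed

text \<open>Bounds the number of accesses left in the present pass: the remaining reads and at most
  two CAS operations.\<close>

fun rank :: "control \<Rightarrow> nat" where
  "rank (Collect J) = card J + 2"
| "rank (Line6 x) = 2"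
| "rank (Line8 x) = 1"
| "rank (Returned q) = 0"

text \<open>Two descents. The first runs out the pass that is under way at \<open>T\<close>, whose
  view may be outdated. The second follows a complete pass over constant registers, which can only
  end without an attempted CAS.\<close>

lemma eventually_won:
  assumes const: "\<And>t y. T \<le> t \<Longrightarrow> y \<in> {1..m} \<Longrightarrow> regs (C t) y = regs (C T) y"
    and i: "i \<in> {1..n}"
    and never: "\<And>t. returned code (C t) i = None"
  shows "\<exists>t\<ge>T. v \<le> won (locals (C t) i) \<and> sum (regs (C t)) {1..m} < v * n"
proof -
  let ?s = "\<lambda>t. locals (C t) i"
  have fair: "\<exists>t'\<ge>t. sched t' = i" for t
    using exec i never unfolding execution_def by blast
  have st: "step code m f i (C t) (C (Suc t))" if "sched t = i" for t
    using step_scheduled[of t] never that by simp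
  have pc: "pc (?s t) \<noteq> Returned q" for t q
    using never[of t] by (auto simp: returned_code split: control.splits)
  have fail: "regs (C t) (f i x) \<noteq> myview (?s t) x"
    if "T \<le> t" "sched t = i" "pc (?s t) \<in> {Line6 x, Line8 x}" for t x
  proof
    assume eq: "regs (C t) (f i x) = myview (?s t) x"
    have "x \<in> {1..m}" using local_inv_run[OF i, of t] that(3) by (auto simp: local_inv_def)
    then have same: "regs (C (Suc t)) (f i x) = regs (C t) (f i x)"
      using const[of t] const[of "Suc t"] that(1) f_in[OF i] by simp
    from st[OF that(2)] show False
      by (cases rule: step_code_cases) (use same that(3) eq in auto)
  qed
  \<comment> \<open>First descent: by \<open>fail\<close> every CAS from \<open>T\<close> on is
    unsuccessful, so each turn either restarts the loop or lowers the rank.\<close>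
  have "\<exists>t\<ge>T. pc (?s t) = Collect {1..m}"
  proof (rule descent_along_schedule[where P = "\<lambda>_. True" and rank = "\<lambda>s. rank (pc s)"
        and G = "\<lambda>s. pc s = Collect {1..m}" and s = ?s and T = T and i = i])
    fix t assume t: "T \<le> t" "sched t = i"
    from st[OF t(2)] show "pc (?s (Suc t)) = Collect {1..m} \<or>
        True \<and> rank (pc (?s (Suc t))) < rank (pc (?s t))"
    proof (cases rule: step_code_cases)
      case (collect J j s')
      have "finite J" using local_inv_run[OF i, of t] collect(1)
        by (auto simp: local_inv_def intro: finite_subset)
      then show ?thesis using collect by (simp add: card_Diff1_less del: card_Diff_insert)
    next
      case (collected j s')
      show ?thesis using collected(3) by (cases rule: line3_cases) (use collected in auto)
    next
      case (won x)
      then show ?thesis using fail[OF t] by simp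
    next
      case (elected x)
      then show ?thesis using fail[OF t] by simp
    next
      case (failed6 x)
      then show ?thesis by (cases x "?s t" rule: line7_cases) auto
    next
      case (failed8 x)
      then show ?thesis by (cases "?s t" rule: line10_cases) auto
    qed
  qed (use fair locals_unscheduled in auto)
  then obtain t0 where t0: "T \<le> t0" "pc (?s t0) = Collect {1..m}" by blast
  define fresh where "fresh s \<longleftrightarrow>
    (\<forall>j\<in>{1..m} - pending (pc s). myview s j = regs (C T) (f i j))" for s :: local_state
  have "\<exists>t\<ge>t0. v \<le> won (?s t) \<and> sum (regs (C T)) {1..m} < v * n"
  proof (rule descent_along_schedule[where P = fresh and rank = "\<lambda>s. rank (pc s)"
        and G = "\<lambda>s. v \<le> won s \<and> sum (regs (C T)) {1..m} < v * n"
        and s = ?s and T = T and i = i])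
    fix t assume t: "T \<le> t" "sched t = i" and fr: "fresh (?s t)"
    have regs: "regs (C t) (f i x) = regs (C T) (f i x)" if "x \<in> {1..m}" for x
      using const[OF t(1) f_in[OF i that]] .
    \<comment> \<open>With an exact view the CAS would succeed, contradicting \<open>fail\<close>.
      Hence when a fresh process moves to a CAS, the rank drops, but its next turn is
      impossible.\<close>
    have nofail: "pc (?s t) \<notin> {Line6 x, Line8 x}" for x
    proof
      assume x: "pc (?s t) \<in> {Line6 x, Line8 x}"
      then have xm: "x \<in> {1..m}" using local_inv_run[OF i, of t] by (auto simp: local_inv_def)
      then have "myview (?s t) x = regs (C T) (f i x)"
        using fr x by (auto simp: fresh_def)
      then show False using fail[OF t x] regs[OF xm] by simp
    qed
    from st[OF t(2)] show "(v \<le> won (?s (Suc t)) \<and> sum (regs (C T)) {1..m} < v * n) \<or>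
        fresh (?s (Suc t)) \<and> rank (pc (?s (Suc t))) < rank (pc (?s t))"
    proof (cases rule: step_code_cases)
      case (collect J j s')
      have "finite J" using local_inv_run[OF i, of t] collect(1)
        by (auto simp: local_inv_def intro: finite_subset)
      then have "rank (pc (?s (Suc t))) < rank (pc (?s t))"
        using collect by (simp add: card_Diff1_less del: card_Diff_insert)
      moreover have "fresh (?s (Suc t))"
      proof -
        have "\<forall>k\<in>{1..m} - J. myview (?s t) k = regs (C T) (f i k)"
          using fr collect(1) by (simp add: fresh_def)
        then have "fresh s'" unfolding fresh_def collect(5) using regs by auto
        then show ?thesis using collect(6) by simp
      qed
      ultimately show ?thesis by blast
    next
      case (collected j s')
      let ?r = "(?s t)\<lparr>myview := (myview (?s t))(j := regs (C t) (f i j)), pc := Collect {}\<rparr>"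
      have view: "\<forall>k\<in>{1..m}. myview ?r k = regs (C T) (f i k)"
      proof -
        have "\<forall>k\<in>{1..m} - {j}. myview (?s t) k = regs (C T) (f i k)"
          using fr collected(1) by (simp add: fresh_def)
        then show ?thesis using regs by simp
      qed
      then have sum: "sum (myview ?r) {1..m} = sum (regs (C T)) {1..m}"
        using sum_reindex[OF i, of "regs (C T)"] by simp
      show ?thesis using collected(3)
      proof (cases rule: line3_cases)
        case (line6 x)
        then show ?thesis using collected(1,4) view by (simp add: fresh_def)
      next
        case (line8 x)
        then show ?thesis using collected(1,4) view by (simp add: fresh_def)
      next
        case again
        \<comment> \<open>If all entries were full, the sum would be \<open>u * m\<close> and the
          loop would have been left. So the other reason for a pass without CAS remains.\<close>
        have "\<not> (\<forall>x\<in>{1..m}. u \<le> myview ?r x)"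
        proof
          assume "\<forall>x\<in>{1..m}. u \<le> myview ?r x"
          then have "(\<Sum>x\<in>{1..m}. u) \<le> sum (myview ?r) {1..m}" by (intro sum_mono) blast
          then have "u * m \<le> sum (myview ?r) {1..m}" by (simp add: mult.commute)
          then show False using again(2) sum sum_regs_le[of T] by linarith
        qed
        then have "v \<le> won ?r \<and> sum (regs (C T)) {1..m} < v * n" using again(3) sum by metis
        then show ?thesis using again(1) collected(4) by simp
      next
        case exit
        then show ?thesis using pc[of "Suc t" NotLeader] collected(4) by simp
      qed
    next
      case (won x)
      then show ?thesis using nofail[of x] by simp
    next
      case (elected x)
      then show ?thesis using nofail[of x] by simp
    next
      case (failed6 x)
      then show ?thesis using nofail[of x] by simp
    next
      case (failed8 x)
      then show ?thesis using nofail[of x] by simp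
    qed
  qed (use fair locals_unscheduled t0 in \<open>auto simp: fresh_def\<close>)
  then obtain t where t: "t0 \<le> t" "v \<le> won (?s t)" "sum (regs (C T)) {1..m} < v * n" by blast
  moreover have "sum (regs (C t)) {1..m} = sum (regs (C T)) {1..m}"
    using t0(1) t(1) by (intro sum.cong refl const) simp_all
  ultimately show ?thesis using t0(1) by (metis le_trans)
qed

text \<open>One process running forever keeps the final sum below \<open>v * n\<close>; then all
  processes run forever, so all counters reach \<open>v\<close>, and their sum is too large.\<close>

lemma every_process_returns:
  assumes i: "i \<in> {1..n}"
  shows "\<exists>t. returned code (C t) i \<noteq> None"
proof (rule ccontr)
  assume "\<nexists>t. returned code (C t) i \<noteq> None"
  then have never: "returned code (C t) i = None" for t by blast
  obtain T where const: "\<And>t y. T \<le> t \<Longrightarrow> y \<in> {1..m} \<Longrightarrow> regs (C t) y = regs (C T) y"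
    using regs_eventually_constant by blast
  have sums: "sum (regs (C t)) {1..m} = sum (regs (C T)) {1..m}" if "T \<le> t" for t
    using that by (intro sum.cong refl const)
  then have less: "sum (regs (C T)) {1..m} < v * n"
    using eventually_won[OF const i never] by metis
  have never': "returned code (C t) k = None" if k: "k \<in> {1..n}" for t k
  proof (rule ccontr)
    assume "returned code (C t) k \<noteq> None"
    \<comment> \<open>A return is permanent, so it can be moved to a time where the sum has its
      final value.\<close>
    then have "returned code (C (max t T)) k \<noteq> None"
      using locals_returned[of t k _ "max t T"] by (auto simp: returned_def)
    then show False using sum_regs_returned[OF k, of "max t T"] sums[of "max t T"] less by simp
  qed
  \<comment> \<open>Counters never decrease, and there are finitely many processes, so one time
    serves for all of them.\<close>
  have "eventually (\<lambda>t. v \<le> won (locals (C t) k)) sequentially" if "k \<in> {1..n}" for k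
    using eventually_won[OF const that never'[OF that]] won_mono
    unfolding eventually_sequentially by (metis le_trans)
  then have "eventually (\<lambda>t. \<forall>k\<in>{1..n}. v \<le> won (locals (C t) k)) sequentially"
    by (simp add: eventually_ball_finite)
  then obtain N where N: "\<And>t. N \<le> t \<Longrightarrow> \<forall>k\<in>{1..n}. v \<le> won (locals (C t) k)"
    unfolding eventually_sequentially by blast
  have "(\<Sum>k\<in>{1..n}. v) \<le> (\<Sum>k\<in>{1..n}. won (locals (C (max N T)) k))"
    using N[of "max N T"] by (intro sum_mono) auto
  then have "v * n \<le> sum (regs (C (max N T))) {1..m}"
    unfolding sum_regs_won by (simp add: mult.commute)
  then show False using sums[of "max N T"] less by simp
qed

section \<open>Counting the elected processes\<close>

lemma leaders_mono: "t \<le> t' \<Longrightarrow> leaders (C t) \<subseteq> leaders (C t')"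
  using locals_returned[of t _ Leader t'] by (auto simp: in_leaders_iff returned_def)

lemma card_leaders_le: "card (leaders (C t)) \<le> d"
  using sum_regs_elected[of t] sum_regs_le[of t] balance by (cases "leaders (C t) = {}") auto

text \<open>For the lower bound, \<open>d < n\<close> provides a process that is never elected. It
  returns \<open>NotLeader\<close>, so the registers are full, and the counters cover at most
  \<open>v * n\<close> of \<open>u * m = v * n + d\<close>.\<close>

lemma exact: "card {i \<in> {1..n}. \<exists>t. returned code (C t) i = Some Leader} = d"
proof -
  let ?L = "{i \<in> {1..n}. \<exists>t. returned code (C t) i = Some Leader}"
  have L: "?L = {i \<in> {1..n}. \<exists>t. i \<in> leaders (C t)}"
    by (auto simp: in_leaders_iff)
  \<comment> \<open>Leaders remain leaders, so from some time \<open>N\<close> on the set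
    \<open>?L\<close> is the set of leaders of a single configuration, to which the counting
    applies.\<close>
  have "eventually (\<lambda>t. i \<in> ?L \<longrightarrow> i \<in> leaders (C t)) sequentially" for i
    unfolding L eventually_sequentially using leaders_mono by blast
  then have "eventually (\<lambda>t. \<forall>i\<in>{1..n}. i \<in> ?L \<longrightarrow> i \<in> leaders (C t)) sequentially"
    by (intro eventually_ball_finite) auto
  then obtain N where "\<And>t. N \<le> t \<Longrightarrow> ?L \<subseteq> leaders (C t)"
    unfolding eventually_sequentially by blast
  then have N: "?L = leaders (C t)" if "N \<le> t" for t
    unfolding L using that by (auto simp: leaders_def)
  have le: "card ?L \<le> d" using N[of N] card_leaders_le by simp
  then have "?L \<noteq> {1..n}" using d_less by auto
  then obtain i where i: "i \<in> {1..n}" "i \<notin> ?L" by blast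
  obtain t q where q: "returned code (C t) i = Some q" using every_process_returns[OF i(1)] by blast
  moreover have "q \<noteq> Leader" using q i by blast
  ultimately have t: "returned code (C t) i = Some NotLeader" by (cases q) auto
  let ?t = "max N t"
  have "returned code (C ?t) i = Some NotLeader"
    using locals_returned[OF t, of ?t] t by (simp add: returned_def)
  then have full: "sum (regs (C ?t)) {1..m} = u * m" using sum_regs_NotLeader[OF i(1)] by blast
  have "(\<Sum>k\<in>{1..n}. won (locals (C ?t) k)) \<le> (\<Sum>k\<in>{1..n}. v)"
    using local_inv_run by (intro sum_mono) (simp add: local_inv_def)
  then have "d \<le> card (leaders (C ?t))"
    using sum_regs_won[of ?t] full balance by (simp add: mult.commute)
  then show ?thesis using le N[of ?t] by simp
qed

end

theorem theorem5:
  fixes n m d :: nat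
  assumes "n \<ge> 2" and "m \<ge> 1" and "d \<in> {1..n - 1}" and "gcd m n dvd d"
  shows "solves_exact_election n m d (election_algorithm n m d)"
  unfolding solves_exact_election_def election_algorithm_def
proof (intro allI impI)
  fix f sched C
  assume "\<forall>i\<in>{1..n}. f i permutes {1..m}"
    and "execution (election_code.code n m (least_u n m d) (least_v n m d)) n m f sched C"
  then interpret election_run n m "least_u n m d" "least_v n m d" d f sched C
    using assms least_solution[of n m d] by unfold_locales auto
  show "(\<forall>i\<in>{1..n}. \<exists>t. returned code (C t) i \<noteq> None) \<and>
    card {i \<in> {1..n}. \<exists>t. returned code (C t) i = Some Leader} = d"
    using every_process_returns exact by blast
qed

end
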